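(* Let $g\in\mathbb{R}^n\setminus\{0\}$, let $H$ be a real symmetric $n\times n$ matrix, and let $\rho:\mathbb{R}\to[0,\infty]$ be a proper closed convex function with $\rho(0)=0$. Suppose that $\rho$ is nondecreasing, $\rho(t)=0$ for all $t\le 0$, and there exists $t_0>0$ with $\rho(t_0)<\infty$. Then $x^*\in\mathbb{R}^n$ is an optimal solution (global minimizer) of $$\inf_{x\in\mathbb{R}^n}\ 2g^Tx+x^THx+\rho(\|x\|^2)$$ if and only if there exists $\lambda^*\in\mathbb{R}$ such that $$(H-\lambda^*I)x^*=-g,\qquad H-\lambda^*I\succeq 0,\qquad \lambda^*\le 0,\qquad -\lambda^*\in\partial(\rho+\delta_{\mathbb{R}_+})(\|x^*\|^2).$$
   Context: $\|\cdot\|$ is the Euclidean norm, $I$ the identity matrix, $A\succeq 0$ means positive semidefinite. $\mathbb{R}_+=[0,\infty)$, $\delta_C$ is the indicator function of a set $C$ (value $0$ on $C$ and $+\infty$ off $C$), and $\partial f$ is the convex subdifferential of a proper convex function $f$ (empty outside the domain of $f$). *)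

theory Defs
  imports "HOL-Analysis.Analysis"
begin

definition epigraph_ereal :: "('a \<Rightarrow> ereal) \<Rightarrow> ('a \<times> real) set" where
  "epigraph_ereal f = {(x, r). f x \<le> ereal r}"

definition proper_fun :: "('a \<Rightarrow> ereal) \<Rightarrow> bool" where
  "proper_fun f \<longleftrightarrow> (\<forall>x. f x \<noteq> -\<infinity>) \<and> (\<exists>x. f x \<noteq> \<infinity>)"

definition convex_fun :: "('a::real_vector \<Rightarrow> ereal) \<Rightarrow> bool" where
  "convex_fun f \<longleftrightarrow> convex (epigraph_ereal f)"

text \<open>For proper functions, closedness of the epigraph is the usual notion of a closed
  function, i.e. lower semicontinuity.\<close>

definition closed_fun :: "('a::topological_space \<Rightarrow> ereal) \<Rightarrow> bool" where
  "closed_fun f \<longleftrightarrow> closed (epigraph_ereal f)"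

text \<open>The indicator function of convex analysis (values \<open>0\<close> and \<open>\<infinity>\<close>),
  not the \<open>0\<close>/\<open>1\<close>-valued \<^const>\<open>indicator\<close>.\<close>

definition delta_fun :: "'a set \<Rightarrow> 'a \<Rightarrow> ereal" where
  "delta_fun C x = (if x \<in> C then 0 else \<infinity>)"

text \<open>The conjunct \<open>f x < \<infinity>\<close> makes the subdifferential empty outside the effective domain.\<close>

definition subdifferential :: "('a::real_inner \<Rightarrow> ereal) \<Rightarrow> 'a \<Rightarrow> 'a set" where
  "subdifferential f x = {v. f x < \<infinity> \<and> (\<forall>y. f y \<ge> f x + ereal (v \<bullet> (y - x)))}"

definition psd :: "real ^ 'n ^ 'n \<Rightarrow> bool" where
  "psd A \<longleftrightarrow> transpose A = A \<and> (\<forall>x. 0 \<le> x \<bullet> (A *v x))"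

end

theory Submission
  imports Defs
begin

text \<open>A minimizer \<open>xs\<close> is nonzero, because \<open>\<rho>\<close> grows at most linearly near \<open>0\<close> while
  \<open>- g\<close> is a first-order descent direction. It also minimizes the quadratic on the sphere through
  \<open>xs\<close>; comparing it with its reflections along arbitrary directions yields both the multiplier
  and the semidefiniteness. Comparing \<open>xs\<close> with its positive multiples, and using
  the convexity of \<open>\<rho>\<close> to differentiate at \<open>\<parallel>xs\<parallel>\<^sup>2\<close>, yields the subgradient
  condition, whose instance at \<open>0\<close> is \<open>l \<le> 0\<close>. Conversely, the
  subgradient inequality reduces the problem to the convex quadratic with matrix
  \<open>H - l I\<close>, of which \<open>xs\<close> is a stationary point.\<close>

section \<open>Quadratic forms and their minimizers on spheres\<close>

lemma inner_symmetric_matrix: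
  fixes H :: "real ^ 'n ^ 'n"
  assumes "transpose H = H"
  shows "x \<bullet> (H *v y) = y \<bullet> (H *v x)"
  by (metis assms dot_lmul_matrix inner_commute transpose_matrix_vector)

lemma scaled_mat_1_vec: "(H - l *\<^sub>R mat 1) *v x = H *v x - l *\<^sub>R (x :: real ^ 'n)"
  by (simp add: matrix_vector_mult_diff_rdistrib scaleR_matrix_vector_assoc[symmetric])

lemma transpose_sub_scaled_mat_1:
  fixes H :: "real ^ 'n ^ 'n"
  assumes "transpose H = H"
  shows "transpose (H - l *\<^sub>R mat 1) = H - l *\<^sub>R mat 1"
proof -
  have "H $ i $ j = H $ j $ i" for i j
    by (metis assms transpose_def vec_lambda_beta)
  then show ?thesis
    by (simp add: transpose_def vec_eq_iff mat_def)
qed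

text \<open>Exact Taylor expansion, with \<open>g + H *v x\<close> half the gradient; the step
  \<open>a\<close> is factored out so that the increment can be read off.\<close>

lemma quadratic_add:
  fixes H :: "real ^ 'n ^ 'n"
  assumes "transpose H = H"
  shows "2 * (g \<bullet> (x + a *\<^sub>R d)) + (x + a *\<^sub>R d) \<bullet> (H *v (x + a *\<^sub>R d)) =
    2 * (g \<bullet> x) + x \<bullet> (H *v x) + a * (2 * (d \<bullet> (g + H *v x)) + a * (d \<bullet> (H *v d)))"
  using inner_symmetric_matrix[OF assms, of x d]
  by (simp add: matrix_vector_right_distrib matrix_vector_mult_scaleR inner_add_left
      inner_add_right inner_commute[of d g] algebra_simps)

text \<open>Reflections keep \<open>xs\<close> on its sphere, so each direction \<open>d\<close>
  gives an exact second-order inequality \<open>key\<close>. Directions near the tangential part of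
  the gradient force that part to vanish; \<open>key\<close> then says that the form of
  \<open>H - l I\<close> is nonnegative at \<open>d\<close>.\<close>

lemma sphere_minimizer_multiplier:
  fixes g xs :: "real ^ 'n" and H :: "real ^ 'n ^ 'n"
  assumes sym: "transpose H = H" and nz: "xs \<noteq> 0"
    and min: "\<And>x. norm x = norm xs \<Longrightarrow>
      2 * (g \<bullet> xs) + xs \<bullet> (H *v xs) \<le> 2 * (g \<bullet> x) + x \<bullet> (H *v x)"
  obtains l where "(H - l *\<^sub>R mat 1) *v xs = - g" "psd (H - l *\<^sub>R mat 1)"
proof -
  define w where "w = g + H *v xs"
  define t where "t = xs \<bullet> xs"
  have t: "t > 0" using nz by (simp add: t_def)
  \<comment> \<open>Minimality against the reflected point, cleared of the positive factor
    \<open>4 / (d \<bullet> d)\<^sup>2\<close>.\<close>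
  have key: "(xs \<bullet> d) * ((d \<bullet> d) * (d \<bullet> w) - (xs \<bullet> d) * (d \<bullet> (H *v d))) \<le> 0" for d
  proof (cases "d = 0")
    case False
    define N where "N = d \<bullet> d"
    define p where "p = xs \<bullet> d"
    have N: "N > 0" using False by (simp add: N_def)
    \<comment> \<open>the reflection of \<open>xs\<close> in the hyperplane orthogonal to \<open>d\<close>\<close>
    define a where "a = - 2 * p / N"
    have "(xs + a *\<^sub>R d) \<bullet> (xs + a *\<^sub>R d) = xs \<bullet> xs + a * (2 * p + a * N)"
      by (simp add: inner_add_left inner_add_right inner_commute[of d xs] p_def N_def algebra_simps)
    also have "\<dots> = xs \<bullet> xs" using N by (simp add: a_def)
    finally have "norm (xs + a *\<^sub>R d) = norm xs" by (simp add: norm_eq_sqrt_inner)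
    from min[OF this] have "0 \<le> a * (2 * (d \<bullet> w) + a * (d \<bullet> (H *v d)))"
      unfolding quadratic_add[OF sym] w_def by simp
    also have "\<dots> = - (4 / N\<^sup>2) * (p * (N * (d \<bullet> w) - p * (d \<bullet> (H *v d))))"
      using N by (simp add: a_def field_simps power2_eq_square)
    finally have "(4 / N\<^sup>2) * (p * (N * (d \<bullet> w) - p * (d \<bullet> (H *v d)))) \<le> 0" by linarith
    moreover have "4 / N\<^sup>2 > 0" using N by simp
    ultimately show ?thesis
      unfolding N_def[symmetric] p_def[symmetric] by (metis linorder_not_less mult_pos_pos)
  qed simp
  \<comment> \<open>\<open>l *\<^sub>R xs\<close> is the orthogonal projection of \<open>w\<close>
    on the line of \<open>xs\<close>; the tangential remainder \<open>u\<close> has to be shown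
    zero.\<close>
  define l where "l = (xs \<bullet> w) / t"
  define u where "u = w - l *\<^sub>R xs"
  have ux: "xs \<bullet> u = 0" using t by (simp add: u_def l_def inner_diff_right t_def)
  \<comment> \<open>At \<open>u\<close> itself \<open>key\<close> is void, since
    \<open>xs \<bullet> u = 0\<close>. At \<open>u + e *\<^sub>R xs\<close> the outer factor is
    \<open>e * t > 0\<close> and cancels; then \<open>e\<close> tends to 0.\<close>
  have "(u \<bullet> u) * (u \<bullet> w) \<le> 0"
  proof -
    define d where "d = (\<lambda>e. u + e *\<^sub>R xs)"
    have "((\<lambda>e. (d e \<bullet> d e) * (d e \<bullet> w) - (e * t) * (d e \<bullet> (H *v u + e *\<^sub>R (H *v xs)))) \<longlongrightarrow>
        (u \<bullet> u) * (u \<bullet> w)) (at_right 0)"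
      unfolding d_def by (auto intro!: tendsto_eq_intros)
    moreover have "\<forall>\<^sub>F e in at_right 0.
      (d e \<bullet> d e) * (d e \<bullet> w) - (e * t) * (d e \<bullet> (H *v u + e *\<^sub>R (H *v xs))) \<le> 0"
      using eventually_at_right_less[of 0]
    proof eventually_elim
      case (elim e)
      have "xs \<bullet> d e = e * t" by (simp add: d_def inner_add_right ux t_def)
      moreover have "H *v d e = H *v u + e *\<^sub>R (H *v xs)"
        by (simp add: d_def matrix_vector_right_distrib matrix_vector_mult_scaleR)
      moreover have "e * t > 0" using elim t by simp
      ultimately show ?case using key[of "d e"] by (metis linorder_not_less mult_pos_pos)
    qed
    ultimately show ?thesis by (intro tendsto_upperbound) auto
  qed
  moreover have "u \<bullet> w = u \<bullet> u"
    using ux by (simp add: u_def inner_diff_right inner_diff_left inner_commute)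
  ultimately have "u \<bullet> u = 0"
    using inner_ge_zero[of u] by (auto simp: mult_le_0_iff)
  then have w: "w = l *\<^sub>R xs" by (simp add: u_def)
  \<comment> \<open>With \<open>w = l *\<^sub>R xs\<close>, both terms of \<open>key\<close> contain
    the square of \<open>xs \<bullet> d\<close>.\<close>
  have pos: "0 \<le> d \<bullet> (H *v d) - l * (d \<bullet> d)" if "xs \<bullet> d \<noteq> 0" for d
  proof -
    have "(xs \<bullet> d)\<^sup>2 * (d \<bullet> (H *v d) - l * (d \<bullet> d)) \<ge> 0"
      using key[of d] by (simp add: w inner_commute[of d xs] power2_eq_square algebra_simps)
    then show ?thesis using that by (simp add: zero_le_mult_iff)
  qed
  have "0 \<le> d \<bullet> (H *v d) - l * (d \<bullet> d)" for d
  proof (cases "xs \<bullet> d = 0")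
    case True
    \<comment> \<open>Directions orthogonal to \<open>xs\<close> are limits of directions covered by
      \<open>pos\<close>.\<close>
    define c where "c = (\<lambda>e. d + e *\<^sub>R xs)"
    have "((\<lambda>e. c e \<bullet> (H *v d + e *\<^sub>R (H *v xs)) - l * (c e \<bullet> c e)) \<longlongrightarrow>
        d \<bullet> (H *v d) - l * (d \<bullet> d)) (at_right 0)"
      unfolding c_def by (auto intro!: tendsto_eq_intros)
    moreover have "\<forall>\<^sub>F e in at_right 0.
        0 \<le> c e \<bullet> (H *v d + e *\<^sub>R (H *v xs)) - l * (c e \<bullet> c e)"
      using eventually_at_right_less[of 0]
    proof eventually_elim
      case (elim e)
      have "xs \<bullet> c e = e * t" by (simp add: c_def inner_add_right True t_def)
      moreover have "H *v c e = H *v d + e *\<^sub>R (H *v xs)"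
        by (simp add: c_def matrix_vector_right_distrib matrix_vector_mult_scaleR)
      moreover have "e * t \<noteq> 0" using elim t by simp
      ultimately show ?case using pos[of "c e"] by simp
    qed
    ultimately show ?thesis by (intro tendsto_lowerbound) auto
  qed (rule pos)
  then have "psd (H - l *\<^sub>R mat 1)"
    by (simp add: psd_def transpose_sub_scaled_mat_1[OF sym] scaled_mat_1_vec inner_diff_right)
  moreover have "(H - l *\<^sub>R mat 1) *v xs = - g"
    using w unfolding scaled_mat_1_vec w_def by (simp add: algebra_simps)
  ultimately show ?thesis using that by blast
qed

section \<open>Convexity of \<open>\<rho>\<close> in one-sided limits\<close>

lemma convex_fun_bound:
  fixes f :: "'a::real_vector \<Rightarrow> ereal"
  assumes "convex_fun f" "f x \<le> ereal a" "f y \<le> ereal b" "0 \<le> e" "e \<le> 1"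
  shows "f ((1 - e) *\<^sub>R x + e *\<^sub>R y) \<le> ereal ((1 - e) * a + e * b)"
  using convexD_alt[of "epigraph_ereal f" "(x, a)" "(y, b)" e] assms
  by (simp add: convex_fun_def epigraph_ereal_def)

text \<open>At \<open>- e *\<^sub>R g\<close> the linear term is
  \<open>- 2 * e * (g \<bullet> g)\<close>, while the quadratic term and the chord bound on
  \<open>\<rho>\<close> are of order \<open>e\<^sup>2\<close>. The objective is 0 at the origin, so
  a negative value excludes it. The real bound \<open>r\<close> avoids infinite values.\<close>

lemma zero_not_minimizer:
  fixes g :: "real ^ 'n" and H :: "real ^ 'n ^ 'n"
  assumes "g \<noteq> 0" "convex_fun \<rho>" "\<rho> 0 = 0" "0 < t0" "\<rho> t0 \<le> ereal a"
  shows "\<exists>x r. \<rho> ((norm x)\<^sup>2) \<le> ereal r \<and> 2 * (g \<bullet> x) + x \<bullet> (H *v x) + r < 0"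
proof (rule ccontr)
  assume "\<not> ?thesis"
  then have min: "0 \<le> 2 * (g \<bullet> x) + x \<bullet> (H *v x) + r" if "\<rho> ((norm x)\<^sup>2) \<le> ereal r" for x r
    using that by (meson linorder_not_less)
  define G where "G = g \<bullet> g"
  have G: "G > 0" using assms(1) by (simp add: G_def)
  \<comment> \<open>The chord of \<open>\<rho>\<close> from 0 to \<open>t0\<close>.\<close>
  have bound: "\<rho> s \<le> ereal (s / t0 * a)" if "0 \<le> s" "s \<le> t0" for s
    using convex_fun_bound[OF assms(2), of 0 0 t0 a "s / t0"] assms(3-5) that by simp
  have "((\<lambda>e. e\<^sup>2 * G) \<longlongrightarrow> 0) (at_right 0)"
    by (auto intro!: tendsto_eq_intros)
  then have "\<forall>\<^sub>F e in at_right 0. e\<^sup>2 * G < t0"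
    using assms(4) by (rule order_tendstoD)
  then have "\<forall>\<^sub>F e in at_right 0. 0 \<le> - 2 * G + e * (g \<bullet> (H *v g) + G / t0 * a)"
    using eventually_at_right_less[of 0]
  proof eventually_elim
    case (elim e)
    have "(norm (- e *\<^sub>R g))\<^sup>2 = e\<^sup>2 * G"
      by (simp add: G_def power_mult_distrib flip: power2_norm_eq_inner)
    then have "\<rho> ((norm (- e *\<^sub>R g))\<^sup>2) \<le> ereal (e\<^sup>2 * G / t0 * a)"
      using bound[of "e\<^sup>2 * G"] elim G by simp
    from min[OF this] have "0 \<le> e * (- 2 * G + e * (g \<bullet> (H *v g) + G / t0 * a))"
      using matrix_vector_mult_scaleR[of H "- e" g]
      by (simp add: G_def power2_eq_square algebra_simps)
    then show ?case using elim by (simp add: zero_le_mult_iff)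
  qed
  moreover have "((\<lambda>e. - 2 * G + e * (g \<bullet> (H *v g) + G / t0 * a)) \<longlongrightarrow> - 2 * G) (at_right 0)"
    by (auto intro!: tendsto_eq_intros)
  ultimately have "0 \<le> - 2 * G" by (intro tendsto_lowerbound) auto
  with G show False by simp
qed

text \<open>The premise \<open>ray\<close> is minimality among the points
  \<open>r *\<^sub>R xs\<close>. On the segment from \<open>t\<close> to \<open>s\<close>, convexity
  bounds \<open>\<rho>\<close> by its chord; dividing by the segment parameter \<open>e\<close> and
  letting it tend to 0 removes the term in \<open>h\<close>, which is of second order.\<close>

lemma ray_minimizer_subgradient:
  fixes \<rho> :: "real \<Rightarrow> ereal"
  assumes cvx: "convex_fun \<rho>" and "0 < t" "\<rho> t = ereal a" "\<rho> s \<le> ereal b" "0 \<le> s"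
    and ray: "\<And>r c. 0 \<le> r \<Longrightarrow> \<rho> (r\<^sup>2 * t) \<le> ereal c \<Longrightarrow>
      a + 2 * l * t * (1 - r) - h * (r - 1)\<^sup>2 \<le> c"
  shows "a - l * (s - t) \<le> b"
proof -
  define k where "k = (s - t) / t"
  \<comment> \<open>Chosen so that \<open>(r e)\<^sup>2 * t = (1 - e) * t + e * s\<close>;
    \<open>k \<ge> -1\<close> keeps the radicand nonnegative.\<close>
  define r where "r = (\<lambda>e. sqrt (1 + e * k))"
  have k: "k \<ge> -1" using assms by (simp add: k_def field_simps)
  \<comment> \<open>Here \<open>k / (r e + 1)\<close> is the rationalized difference quotient
    \<open>(r e - 1) / e\<close>, so the limit follows by continuity.\<close>
  have "((\<lambda>e. a - 2 * l * t * (k / (r e + 1)) - h * e * (k / (r e + 1))\<^sup>2) \<longlongrightarrow>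
      a - 2 * l * t * (k / 2)) (at_right 0)"
    unfolding r_def by (auto intro!: tendsto_eq_intros)
  moreover have "\<forall>\<^sub>F e in at_right 0.
      a - 2 * l * t * (k / (r e + 1)) - h * e * (k / (r e + 1))\<^sup>2 \<le> b"
    using eventually_at_right_less[of 0] eventually_at_right_real[OF zero_less_one]
  proof eventually_elim
    case (elim e)
    then have e: "0 < e" "e < 1" by auto
    have "e * (1 + k) \<ge> 0" using e k by simp
    then have nn: "1 + e * k \<ge> 0" using e by (simp add: algebra_simps)
    then have r: "(r e)\<^sup>2 = 1 + e * k" "r e \<ge> 0" by (simp_all add: r_def)
    have "(r e)\<^sup>2 * t = (1 - e) * t + e * s"
      using assms(2) by (simp add: r k_def field_simps)
    then have "\<rho> ((r e)\<^sup>2 * t) \<le> ereal ((1 - e) * a + e * b)"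
      using convex_fun_bound[OF cvx, of t a s b e] assms e by simp
    from ray[OF r(2) this]
    have *: "a + 2 * l * t * (1 - r e) - h * (r e - 1)\<^sup>2 \<le> (1 - e) * a + e * b" .
    have "(r e - 1) * (r e + 1) = e * k"
      using r(1) by (simp add: power2_eq_square algebra_simps)
    then have d: "r e - 1 = e * (k / (r e + 1))"
      using r(2) by (simp add: field_simps)
    define m where "m = k / (r e + 1)"
    have "r e = 1 + e * m" using d by (simp add: m_def)
    with * have "a + 2 * l * t * (- (e * m)) - h * (e * m)\<^sup>2 \<le> (1 - e) * a + e * b" by simp
    then have "e * (a - 2 * l * t * m - h * e * m\<^sup>2) \<le> e * b"
      by (simp add: power2_eq_square algebra_simps)
    then show ?case using e by (simp add: m_def)
  qed
  ultimately have "a - 2 * l * t * (k / 2) \<le> b" by (intro tendsto_upperbound) auto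
  then show ?thesis using assms(2) by (simp add: k_def)
qed

theorem theorem2p2:
  fixes g :: "real ^ 'n" and H :: "real ^ 'n ^ 'n" and \<rho> :: "real \<Rightarrow> ereal"
    and xs :: "real ^ 'n"
  assumes "g \<noteq> 0"
    and "transpose H = H"
    and "\<forall>t. 0 \<le> \<rho> t"
    and "proper_fun \<rho>"
    and "closed_fun \<rho>"
    and "convex_fun \<rho>"
    and "\<rho> 0 = 0"
    and "mono \<rho>"
    and "\<forall>t\<le>0. \<rho> t = 0"
    and "\<exists>t0>0. \<rho> t0 < \<infinity>"
  shows "(\<forall>x. ereal (2 * (g \<bullet> xs) + xs \<bullet> (H *v xs)) + \<rho> ((norm xs)\<^sup>2)
              \<le> ereal (2 * (g \<bullet> x) + x \<bullet> (H *v x)) + \<rho> ((norm x)\<^sup>2))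
    \<longleftrightarrow> (\<exists>l::real.
          (H - l *\<^sub>R mat 1) *v xs = - g \<and>
          psd (H - l *\<^sub>R mat 1) \<and>
          l \<le> 0 \<and>
          - l \<in> subdifferential (\<lambda>t. \<rho> t + delta_fun {0..} t) ((norm xs)\<^sup>2))"
proof -
  define q where "q = (\<lambda>x. 2 * (g \<bullet> x) + x \<bullet> (H *v x))"
  have q_eq: "q x = 2 * (g \<bullet> x) + x \<bullet> (H *v x)" for x by (simp add: q_def)
  define t where "t = (norm xs)\<^sup>2"
  have sym: "transpose H = H" by fact
  show ?thesis
    unfolding q_eq[symmetric] t_def[symmetric]
  proof

    \<comment> \<open>Necessity of the optimality conditions\<close>
    assume min: "\<forall>x. ereal (q xs) + \<rho> t \<le> ereal (q x) + \<rho> ((norm x)\<^sup>2)"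
    \<comment> \<open>Comparison with the origin, which makes \<open>\<rho> t\<close>
      finite.\<close>
    have "ereal (q xs) + \<rho> t \<le> 0"
      using min[rule_format, of 0] \<open>\<rho> 0 = 0\<close> by (simp add: q_def zero_ereal_def)
    then have "\<rho> t \<noteq> \<infinity>" by auto
    moreover have "0 \<le> \<rho> t" using assms(3) by blast
    ultimately obtain a where a: "\<rho> t = ereal a" "0 \<le> a" by (cases "\<rho> t") auto
    have min': "q xs + a \<le> q x + r" if "\<rho> ((norm x)\<^sup>2) \<le> ereal r" for x r
    proof -
      have "ereal (q xs + a) \<le> ereal (q x) + \<rho> ((norm x)\<^sup>2)"
        using min a by simp
      also have "\<dots> \<le> ereal (q x) + ereal r" using that by (rule add_left_mono)
      finally show ?thesis by simp
    qed
    obtain t0 b where t0: "0 < t0" "\<rho> t0 \<le> ereal b"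
      using assms(10) by (metis less_ereal.simps(4) less_imp_le ereal_dense2)
    have nz: "xs \<noteq> 0"
    proof
      assume "xs = 0"
      then have "q xs = 0" "a = 0" using a \<open>\<rho> 0 = 0\<close> by (simp_all add: q_def t_def)
      then show False
        using zero_not_minimizer[OF \<open>g \<noteq> 0\<close> \<open>convex_fun \<rho>\<close> \<open>\<rho> 0 = 0\<close> t0, of H] min'
        by (fastforce simp: q_def)
    qed
    then have t: "t > 0" by (simp add: t_def)
    \<comment> \<open>The \<open>\<rho>\<close> term is constant on the sphere through
      \<open>xs\<close>, so it cancels.\<close>
    have "q xs \<le> q x" if "norm x = norm xs" for x
      using min'[of x a] a that by (simp add: t_def)
    then obtain l where l: "(H - l *\<^sub>R mat 1) *v xs = - g" "psd (H - l *\<^sub>R mat 1)"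
      using sphere_minimizer_multiplier[OF sym nz, of g] unfolding q_def by blast
    have Hx: "H *v xs = l *\<^sub>R xs - g"
      using l(1) unfolding scaled_mat_1_vec by (simp add: algebra_simps)
    define h where "h = xs \<bullet> (H *v xs)"
    have gx: "g \<bullet> xs = l * t - h"
      by (simp add: h_def Hx inner_diff_right t_def power2_norm_eq_inner inner_commute)
    \<comment> \<open>Stationarity eliminates \<open>g \<bullet> xs\<close>, and the quadratic terms
      collect into the square of \<open>r - 1\<close>.\<close>
    have ray: "a + 2 * l * t * (1 - r) - h * (r - 1)\<^sup>2 \<le> c"
      if "\<rho> (r\<^sup>2 * t) \<le> ereal c" for r c
    proof -
      have "\<rho> ((norm (r *\<^sub>R xs))\<^sup>2) \<le> ereal c"
        using that by (simp add: t_def power_mult_distrib)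
      from min'[OF this] show ?thesis
        by (simp add: q_def matrix_vector_mult_scaleR gx h_def[symmetric]
            power2_eq_square algebra_simps)
    qed
    have sub: "a - l * (s - t) \<le> b" if "0 \<le> s" "\<rho> s \<le> ereal b" for s b
      using ray_minimizer_subgradient[OF assms(6) t a(1) that(2,1) ray] by simp
    \<comment> \<open>The instance at 0 reads \<open>a + l * t \<le> 0\<close>, where
      \<open>a \<ge> 0\<close>.\<close>
    have "l * t \<le> 0" using sub[of 0 0] \<open>\<rho> 0 = 0\<close> a by simp
    then have "l \<le> 0" using t by (simp add: mult_le_0_iff)
    moreover have "- l \<in> subdifferential (\<lambda>t. \<rho> t + delta_fun {0..} t) t"
    proof -
      have "ereal (a - l * (s - t)) \<le> \<rho> s + delta_fun {0..} s" for s
      proof (cases "0 \<le> s")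
        case True
        have "0 \<le> \<rho> s" using assms(3) by blast
        with True sub[of s] show ?thesis by (cases "\<rho> s") (auto simp: delta_fun_def)
      next
        case False
        have "0 \<le> \<rho> s" using assms(3) by blast
        with False show ?thesis by (simp add: delta_fun_def)
      qed
      then show ?thesis
        using t a by (simp add: subdifferential_def delta_fun_def)
    qed
    ultimately show "\<exists>l. (H - l *\<^sub>R mat 1) *v xs = - g \<and> psd (H - l *\<^sub>R mat 1) \<and> l \<le> 0 \<and>
        - l \<in> subdifferential (\<lambda>t. \<rho> t + delta_fun {0..} t) t"
      using l by blast
  next

    \<comment> \<open>Sufficiency of the optimality conditions\<close>
    assume "\<exists>l. (H - l *\<^sub>R mat 1) *v xs = - g \<and> psd (H - l *\<^sub>R mat 1) \<and> l \<le> 0 \<and>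
        - l \<in> subdifferential (\<lambda>t. \<rho> t + delta_fun {0..} t) t"
    then obtain l where l: "(H - l *\<^sub>R mat 1) *v xs = - g" "psd (H - l *\<^sub>R mat 1)"
      and sub: "- l \<in> subdifferential (\<lambda>t. \<rho> t + delta_fun {0..} t) t" by blast
    have Hx: "H *v xs = l *\<^sub>R xs - g"
      using l(1) unfolding scaled_mat_1_vec by (simp add: algebra_simps)
    have t: "t \<ge> 0" by (simp add: t_def)
    have subg: "\<rho> t + ereal (- l * (s - t)) \<le> \<rho> s" if "s \<ge> 0" for s
    proof -
      have "\<rho> t + delta_fun {0..} t + ereal (- l \<bullet> (s - t)) \<le> \<rho> s + delta_fun {0..} s"
        using sub by (simp add: subdifferential_def)
      then show ?thesis using that t by (simp add: delta_fun_def)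
    qed
    \<comment> \<open>The two sides differ exactly by the form of \<open>H - l I\<close> at
      \<open>x - xs\<close>: stationarity cancels the linear terms.\<close>
    have quad: "q xs - l * t \<le> q x - l * (norm x)\<^sup>2" for x
    proof -
      define d where "d = x - xs"
      have x: "x = xs + 1 *\<^sub>R d" by (simp add: d_def)
      have "0 \<le> d \<bullet> (H *v d) - l * (d \<bullet> d)"
        using l(2) by (simp add: psd_def scaled_mat_1_vec inner_diff_right)
      moreover have "q x = q xs + 2 * l * (d \<bullet> xs) + d \<bullet> (H *v d)"
        unfolding q_def x quadratic_add[OF sym] by (simp add: Hx)
      moreover have "(norm x)\<^sup>2 = t + 2 * (d \<bullet> xs) + d \<bullet> d"
        by (simp add: x t_def power2_norm_eq_inner inner_add_left inner_add_right inner_commute)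
      ultimately show ?thesis by (simp add: algebra_simps)
    qed
    show "\<forall>x. ereal (q xs) + \<rho> t \<le> ereal (q x) + \<rho> ((norm x)\<^sup>2)"
    proof
      fix x
      \<comment> \<open>\<open>quad\<close> leaves the term
        \<open>- l * ((norm x)\<^sup>2 - t)\<close>, which the subgradient inequality at
        \<open>(norm x)\<^sup>2\<close> absorbs into \<open>\<rho>\<close>.\<close>
      have "ereal (q xs) + \<rho> t \<le> ereal (q x - l * ((norm x)\<^sup>2 - t)) + \<rho> t"
        using quad[of x] by (intro add_right_mono) (simp add: algebra_simps)
      also have "\<dots> = ereal (q x) + (\<rho> t + ereal (- l * ((norm x)\<^sup>2 - t)))"
        by (cases "\<rho> t") simp_all
      also have "\<dots> \<le> ereal (q x) + \<rho> ((norm x)\<^sup>2)"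
        by (intro add_left_mono subg) simp
      finally show "ereal (q xs) + \<rho> t \<le> ereal (q x) + \<rho> ((norm x)\<^sup>2)" .
    qed
  qed
qed

end
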